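(* Let $g,q,z_d\in\mathbb{R}$, $M_3>0$ and $\alpha>0$. Let $u_{\alpha b_{\alpha_{op}}}$ be the solution of $(S_\alpha)$ for $b=b_{\alpha_{op}}$, the minimizer of $J_{3\alpha}$ over $\mathbb{R}$, and for $h=x_0/n$ let $u^h_{\alpha b^h_{\alpha_{op}}}$ be the discrete solution for $b=b^h_{\alpha_{op}}$, the minimizer of $J^h_{3\alpha}$ over $\mathbb{R}$. Then there are constants $C_{15\alpha},C_{16\alpha}$ independent of $h$ such that, as $h\to0$ ($h=x_0/n$, $n\to\infty$), $$\text{(a)}\quad\|u^h_{\alpha b^h_{\alpha_{op}}}-u_{\alpha b_{\alpha_{op}}}\|_H=C_{15\alpha}h+o(h),\qquad\text{(b)}\quad\left\|\frac{\partial u^h_{\alpha b^h_{\alpha_{op}}}}{\partial x}-\frac{\partial u_{\alpha b_{\alpha_{op}}}}{\partial x}\right\|_H=C_{16\alpha}h+o(h).$$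
   Context: Fix $x_0,y_0>0$, $\Omega=(0,x_0)\times(0,y_0)$, $\Gamma_1=\{0\}\times(0,y_0]$, $H=L^2(\Omega)$ with its standard norm, $B=H^{1/2}(\Gamma_1)$. For constants $g,q,b\in\mathbb{R}$ and $\alpha>0$, system $(S_\alpha)$: $-\Delta u=g$ in $\Omega$, $-\partial u/\partial n=\alpha(u-b)$ on $\Gamma_1$, $-\partial u/\partial n=q$ on $\{x_0\}\times(0,y_0]$, $-\partial u/\partial n=0$ on $[0,x_0]\times\{0,y_0\}$, has solution $u_{\alpha b}(x,y)=-\tfrac12gx^2+(gx_0-q)x+\tfrac1\alpha(gx_0-q)+b$. For an integer $n\ge1$, $h=x_0/n$, $x_i=(i-1)h$, its discrete (finite-difference, piecewise linear) approximation is $u^h_{\alpha b}(x,y)=(gx_0-q-hgi)x+b+\tfrac{gx_0-q}\alpha-\tfrac{gh}\alpha+\tfrac{i^2-i}2gh^2$ for $x\in[x_i,x_{i+1}]$, $y\in[0,y_0]$, $i=1,\dots,n$ (its $x$-derivative is piecewise constant, defined a.e.). For fixed $g,q,z_d\in\mathbb{R}$ and $M_3>0$ the cost functions on $\mathbb{R}$ are $J_{3\alpha}(b)=\tfrac12\|u_{\alpha b}-z_d\|_H^2+\tfrac{M_3}2\|b\|_B^2$ and $J^h_{3\alpha}(b)=\tfrac12\|u^h_{\alpha b}-z_d\|_H^2+\tfrac{M_3}2\|b\|_B^2$, where $\|b\|_B^2=y_0b^2$ for constant $b$. The minimizers are $b_{\alpha_{op}}=\left(-\tfrac{gx_0^2}3+\tfrac{qx_0}2+z_d-\tfrac{gx_0-q}\alpha\right)\Big/\left(1+\tfrac{M_3}{x_0}\right)$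 and $b^h_{\alpha_{op}}=b_{\alpha_{op}}+E_1gx_0h\left(1+\tfrac4{\alpha x_0}+\tfrac h{3x_0}\right)$ with $E_1=\tfrac14\left(1+\tfrac{M_3}{x_0}\right)^{-1}$. *)

theory Defs
  imports "HOL-Analysis.Analysis" "HOL-Library.Landau_Symbols"
begin

definition Omega :: "real \<Rightarrow> real \<Rightarrow> (real \<times> real) set" where
  "Omega x0 y0 = {0<..<x0} \<times> {0<..<y0}"

text \<open>
  Solutions of the system are taken in the classical sense: \<open>u\<close> has a gradient \<open>G\<close> that is
  continuous on the closed rectangle (one-sided derivatives on the boundary), and the second
  partial derivatives \<open>uxx\<close> and \<open>uyy\<close> exist and are continuous in the open rectangle.
  The normal derivative is the inner product of \<open>G\<close> with the outward unit normal of the side.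
\<close>

definition solves_S ::
  "real \<Rightarrow> real \<Rightarrow> real \<Rightarrow> real \<Rightarrow> real \<Rightarrow> real \<Rightarrow> (real \<times> real \<Rightarrow> real) \<Rightarrow> bool" where
  "solves_S x0 y0 g q \<alpha> b u \<longleftrightarrow>
    (\<exists>G :: real \<times> real \<Rightarrow> real \<times> real. \<exists>uxx uyy :: real \<times> real \<Rightarrow> real.
      (\<forall>z\<in>{0..x0} \<times> {0..y0}.
         (u has_derivative (\<lambda>v. G z \<bullet> v)) (at z within {0..x0} \<times> {0..y0})) \<and>
      continuous_on ({0..x0} \<times> {0..y0}) G \<and>
      (\<forall>(x, y)\<in>Omega x0 y0.
         ((\<lambda>s. fst (G (s, y))) has_real_derivative uxx (x, y)) (at x) \<and>
         ((\<lambda>t. snd (G (x, t))) has_real_derivative uyy (x, y)) (at y)) \<and>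
      continuous_on (Omega x0 y0) uxx \<and> continuous_on (Omega x0 y0) uyy \<and>
      (\<forall>z\<in>Omega x0 y0. - (uxx z + uyy z) = g) \<and>
      (\<forall>z\<in>{0} \<times> {0<..y0}. - (G z \<bullet> (-1, 0)) = \<alpha> * (u z - b)) \<and>
      (\<forall>z\<in>{x0} \<times> {0<..y0}. - (G z \<bullet> (1, 0)) = q) \<and>
      (\<forall>z\<in>{0..x0} \<times> {0}. - (G z \<bullet> (0, -1)) = 0) \<and>
      (\<forall>z\<in>{0..x0} \<times> {y0}. - (G z \<bullet> (0, 1)) = 0))"

text \<open>The explicit solution; in particular \<open>solves_S\<close> is satisfiable for all data.\<close>

lemma solves_S_explicit:
  assumes "\<alpha> > 0"
  shows "solves_S x0 y0 g q \<alpha> b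
    (\<lambda>(x, y). - (1/2) * g * x\<^sup>2 + (g * x0 - q) * x + (1/\<alpha>) * (g * x0 - q) + b)"
  unfolding solves_S_def
proof (rule exI[of _ "\<lambda>z. (- g * fst z + (g * x0 - q), 0)"],
    rule exI[of _ "\<lambda>_. - g"], rule exI[of _ "\<lambda>_. 0"], intro conjI)
  let ?G = "\<lambda>z::real \<times> real. (- g * fst z + (g * x0 - q), 0::real)"
  let ?S = "{0..x0} \<times> {0..y0}"
  show "\<forall>z\<in>?S. ((\<lambda>(x, y). - (1/2) * g * x\<^sup>2 + (g * x0 - q) * x + (1/\<alpha>) * (g * x0 - q) + b)
      has_derivative (\<lambda>v. ?G z \<bullet> v)) (at z within ?S)"
  proof
    fix z assume "z \<in> ?S"
    have "((\<lambda>w. - (1/2) * g * (fst w)\<^sup>2 + (g * x0 - q) * fst w + (1/\<alpha>) * (g * x0 - q) + b)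
        has_derivative (\<lambda>v. - (1/2) * g * (2 * fst z * fst v) + (g * x0 - q) * fst v)) (at z within ?S)"
      by (auto intro!: derivative_eq_intros)
    moreover have "(\<lambda>v. - (1/2) * g * (2 * fst z * fst v) + (g * x0 - q) * fst v) = (\<lambda>v. ?G z \<bullet> v)"
      by (rule ext) (simp add: inner_prod_def algebra_simps)
    ultimately show "((\<lambda>(x, y). - (1/2) * g * x\<^sup>2 + (g * x0 - q) * x + (1/\<alpha>) * (g * x0 - q) + b)
      has_derivative (\<lambda>v. ?G z \<bullet> v)) (at z within ?S)"
      by (simp add: case_prod_unfold)
  qed
  show "continuous_on ?S ?G"
    by (intro continuous_intros)
  show "\<forall>(x, y)\<in>Omega x0 y0.
         ((\<lambda>s. fst (?G (s, y))) has_real_derivative - g) (at x) \<and>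
         ((\<lambda>t. snd (?G (x, t))) has_real_derivative 0) (at y)"
    by (auto intro!: derivative_eq_intros)
  show "\<forall>z\<in>{0} \<times> {0<..y0}. - (?G z \<bullet> (-1, 0)) = \<alpha> *
      ((case z of (x, y) \<Rightarrow> - (1/2) * g * x\<^sup>2 + (g * x0 - q) * x + (1/\<alpha>) * (g * x0 - q) + b) - b)"
    using assms by auto
qed (auto simp: algebra_simps)

text \<open>
  On \<open>[x_i, x_(i+1)] = [(i-1)h, ih]\<close> the discrete solution is the affine function with index
  \<open>i\<close>. At a common node of two cells both expressions agree (see the lemma below), so the choice
  of the left cell made by the ceiling is immaterial.
\<close>

definition cell :: "real \<Rightarrow> real \<Rightarrow> nat" where
  "cell h x = max 1 (nat \<lceil>x / h\<rceil>)"

definition discrete_sol ::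
  "real \<Rightarrow> real \<Rightarrow> real \<Rightarrow> real \<Rightarrow> nat \<Rightarrow> real \<Rightarrow> real \<times> real \<Rightarrow> real" where
  "discrete_sol x0 g q \<alpha> n b = (\<lambda>(x, y).
     let h = x0 / real n; i = real (cell h x) in
       (g * x0 - q - h * g * i) * x + b + (g * x0 - q) / \<alpha> - g * h / \<alpha> + (i\<^sup>2 - i) / 2 * g * h\<^sup>2)"

lemma discrete_sol_on_cell:
  assumes "x0 > 0" "n \<ge> 1" "h = x0 / real n" "i \<in> {1..n}"
    and "x \<in> {(real i - 1) * h .. real i * h}"
  shows "discrete_sol x0 g q \<alpha> n b (x, y) =
    (g * x0 - q - h * g * real i) * x + b + (g * x0 - q) / \<alpha> - g * h / \<alpha>
      + ((real i)\<^sup>2 - real i) / 2 * g * h\<^sup>2"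
proof -
  have h: "h > 0" using assms by simp
  show ?thesis
  proof (cases "x = (real i - 1) * h \<and> i \<noteq> 1")
    case True
    with assms(4) have i: "i \<ge> 2" by simp
    from True h i have "x / h = real (i - 1)" by simp
    with i have "cell h x = i - 1" unfolding cell_def by (simp only: ceiling_of_nat nat_int)
    with i have "real (cell h ((real i - 1) * h)) = real i - 1" by (simp flip: conjunct1[OF True])
    then show ?thesis
      unfolding discrete_sol_def Let_def assms(3)[symmetric] prod.case conjunct1[OF True]
      by (simp only:) (simp add: power2_eq_square field_simps)
  next
    case False
    have "cell h x = i"
    proof (cases "x = (real i - 1) * h")
      case True
      with False have "i = 1" "x = 0" by auto
      then show ?thesis by (simp add: cell_def)
    next
      case neq: False
      then have "real i - 1 < x / h" "x / h \<le> real i"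
        using h assms(5) by (simp_all add: less_divide_eq divide_le_eq)
      then have "\<lceil>x / h\<rceil> = int i" by (simp add: ceiling_eq_iff)
      then show ?thesis using assms(4) by (simp add: cell_def)
    qed
    then show ?thesis
      unfolding discrete_sol_def Let_def assms(3)[symmetric] prod.case by simp
  qed
qed

definition norm_H :: "real \<Rightarrow> real \<Rightarrow> (real \<times> real \<Rightarrow> real) \<Rightarrow> real" where
  "norm_H x0 y0 f = sqrt (set_lebesgue_integral lborel (Omega x0 y0) (\<lambda>z. (f z)\<^sup>2))"

text \<open>The norm of \<open>B = H^(1/2)({0} \<times> (0, y0])\<close> on constants, where it is the \<open>L^2\<close> norm.\<close>

definition norm_B :: "real \<Rightarrow> real \<Rightarrow> real" where
  "norm_B y0 b = sqrt (y0 * b\<^sup>2)"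

text \<open>Both costs: \<open>S b\<close> is the continuous or the discrete state belonging to the control \<open>b\<close>.\<close>

definition cost ::
  "real \<Rightarrow> real \<Rightarrow> real \<Rightarrow> real \<Rightarrow> (real \<Rightarrow> real \<times> real \<Rightarrow> real) \<Rightarrow> real \<Rightarrow> real" where
  "cost x0 y0 M3 zd S b =
     1/2 * (norm_H x0 y0 (\<lambda>z. S b z - zd))\<^sup>2 + M3 / 2 * (norm_B y0 b)\<^sup>2"

text \<open>
  For discrete solutions this is an arbitrary value where \<open>x\<close> is a node at which the function
  has a kink; these points form a null set and do not influence \<open>norm_H\<close>.
\<close>

definition ddx :: "(real \<times> real \<Rightarrow> real) \<Rightarrow> real \<times> real \<Rightarrow> real" where
  "ddx f = (\<lambda>(x, y). deriv (\<lambda>s. f (s, y)) x)"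

end

theory Submission
  imports Defs
begin

text \<open>
  Both states are explicit, and the control enters each of them as an additive constant. The
  discrete state is given by a formula; the continuous one equals the known explicit solution
  because the boundary value problem has at most one solution (\<open>solves_S_unique\<close>), by a maximum
  principle with a barrier (\<open>homogeneous_solution_nonpos\<close>).

  Write \<open>h = x0 / n\<close>. For equal controls the discrete state differs from the exact one by
  \<open>h d + O(h\<^sup>2)\<close> uniformly on the rectangle, where \<open>d (x, y) = - g (x / 2 + 1 / \<alpha>)\<close>
  (\<open>discrete_error_expansion\<close>). Each cost is a quadratic polynomial in the control, so its
  minimizer is minus the integral of the state for control \<open>0\<close> minus \<open>zd\<close>, divided by a constant
  common to both costs (\<open>cost_minimizer\<close>). Integrating the expansion gives
  \<open>bh_op n - b_op = \<kappa> h + O(h\<^sup>2)\<close> with a constant \<open>\<kappa>\<close> (\<open>control_error_expansion\<close>). The optimal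
  states therefore differ by \<open>h (d + \<kappa>) + O(h\<^sup>2)\<close>, and (a) holds with \<open>C15\<close> the norm of \<open>d + \<kappa>\<close>
  (\<open>norm_H_linear_rate\<close>).

  In (b) the controls disappear. The difference of the derivatives is \<open>g\<close> times a sawtooth of
  amplitude \<open>h\<close>, whose norm is \<open>\<bar>g\<bar> sqrt (x0 y0 / 3) h\<close> exactly (\<open>norm_H_ddx_error\<close>).
\<close>

section \<open>Uniqueness for the mixed boundary value problem\<close>

lemma second_derivative_nonpos_at_local_max:
  fixes f f' :: "real \<Rightarrow> real"
  assumes f: "\<forall>\<^sub>F s in nhds x. (f has_real_derivative f' s) (at s)"
    and f': "(f' has_real_derivative c) (at x)"
    and max: "\<forall>\<^sub>F s in nhds x. f s \<le> f x"
  shows "c \<le> 0"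
proof (rule ccontr)
  assume "\<not> c \<le> 0"
  then obtain d where d: "d > 0" "\<And>t. t > 0 \<Longrightarrow> t < d \<Longrightarrow> f' x < f' (x + t)"
    using has_real_derivative_pos_inc_right[OF f'] by auto
  obtain r where r: "r > 0" "\<And>s. dist s x < r \<Longrightarrow> (f has_real_derivative f' s) (at s) \<and> f s \<le> f x"
    using eventually_conj[OF f max] unfolding eventually_nhds_metric by auto
  have "(f has_real_derivative f' x) (at x)" using r by simp
  then have "f' x = 0"
    by (rule DERIV_local_max[OF _ r(1)]) (use r in \<open>auto simp: dist_real_def abs_minus_commute\<close>)
  define t where "t = min d r / 2"
  have t: "t > 0" "t < d" "t < r" using d(1) r(1) by (auto simp: t_def)
  obtain z where z: "z > x" "z < x + t" "f (x + t) - f x = (x + t - x) * f' z"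
    using MVT2[of x "x + t" f f'] t r(2) by (auto simp: dist_real_def)
  have "f' z > 0" using d(2)[of "z - x"] z t \<open>f' x = 0\<close> by simp
  then have "0 < t * f' z" using t by simp
  then have "f (x + t) > f x" using z(3) by simp
  moreover have "f (x + t) \<le> f x" using r(2)[of "x + t"] t by (simp add: dist_real_def)
  ultimately show False by simp
qed

text \<open>
  The first-order condition at a maximum point that may lie on the boundary, also at a corner:
  moving from \<open>p\<close> towards another point of a convex set cannot increase the function. It replaces
  a case distinction between sides and corners of the rectangle.
\<close>

lemma directional_derivative_nonpos_at_max:
  fixes f :: "'a::real_normed_vector \<Rightarrow> real"
  assumes "convex K" and "p \<in> K" and "p + d \<in> K"
    and f: "(f has_derivative f') (at p within K)"
    and max: "\<And>z. z \<in> K \<Longrightarrow> f z \<le> f p"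
  shows "f' d \<le> 0"
proof -
  have seg: "p + t *\<^sub>R d \<in> K" if "t \<in> {0..1}" for t
    using convexD_alt[OF assms(1-3), of t] that by (simp add: algebra_simps)
  have "((\<lambda>t. f (p + t *\<^sub>R d)) has_derivative (\<lambda>t. f' (t *\<^sub>R d))) (at 0 within {0..1})"
  proof (rule has_derivative_in_compose[where g = f and g' = f'])
    show "((\<lambda>t. p + t *\<^sub>R d) has_derivative (\<lambda>t. t *\<^sub>R d)) (at 0 within {0..1})"
      by (auto intro!: derivative_eq_intros)
    show "(f has_derivative f') (at (p + 0 *\<^sub>R d) within (\<lambda>t. p + t *\<^sub>R d) ` {0..1})"
      using seg by (auto intro!: has_derivative_subset[OF f])
  qed
  then have "((\<lambda>t. f (p + t *\<^sub>R d)) has_real_derivative f' d) (at 0 within {0..1})"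
    using has_derivative_bounded_linear[OF f]
    by (simp add: has_field_derivative_def linear_simps mult_commute_abs)
  then have lim: "((\<lambda>t. (f (p + t *\<^sub>R d) - f p) / t) \<longlongrightarrow> f' d) (at 0 within {0..1})"
    by (simp add: has_field_derivative_iff)
  show ?thesis
    by (rule tendsto_upperbound[OF lim])
       (use seg max in \<open>auto simp: eventually_at_filter divide_le_0_iff trivial_limit_within islimpt_Icc\<close>)
qed

lemma solves_S_diff:
  assumes "solves_S x0 y0 g q \<alpha> b u" and "solves_S x0 y0 g' q' \<alpha> b' u'"
  shows "solves_S x0 y0 (g - g') (q - q') \<alpha> (b - b') (\<lambda>z. u z - u' z)"
proof -
  let ?K = "{0..x0} \<times> {0..y0}"
  obtain G uxx uyy where G:
      "\<And>z. z \<in> ?K \<Longrightarrow> (u has_derivative (\<lambda>v. G z \<bullet> v)) (at z within ?K)"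
      "continuous_on ?K G"
      "\<And>x y. (x, y) \<in> Omega x0 y0 \<Longrightarrow>
         ((\<lambda>s. fst (G (s, y))) has_real_derivative uxx (x, y)) (at x) \<and>
         ((\<lambda>t. snd (G (x, t))) has_real_derivative uyy (x, y)) (at y)"
      "continuous_on (Omega x0 y0) uxx" "continuous_on (Omega x0 y0) uyy"
      "\<And>z. z\<in>Omega x0 y0 \<Longrightarrow> - (uxx z + uyy z) = g"
      "\<And>z. z\<in>{0} \<times> {0<..y0} \<Longrightarrow> - (G z \<bullet> (-1, 0)) = \<alpha> * (u z - b)"
      "\<And>z. z\<in>{x0} \<times> {0<..y0} \<Longrightarrow> - (G z \<bullet> (1, 0)) = q"
      "\<And>z. z\<in>{0..x0} \<times> {0} \<Longrightarrow> - (G z \<bullet> (0, -1)) = 0"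
      "\<And>z. z\<in>{0..x0} \<times> {y0} \<Longrightarrow> - (G z \<bullet> (0, 1)) = 0"
    using assms(1) unfolding solves_S_def by fast
  obtain G' uxx' uyy' where G':
      "\<And>z. z \<in> ?K \<Longrightarrow> (u' has_derivative (\<lambda>v. G' z \<bullet> v)) (at z within ?K)"
      "continuous_on ?K G'"
      "\<And>x y. (x, y) \<in> Omega x0 y0 \<Longrightarrow>
         ((\<lambda>s. fst (G' (s, y))) has_real_derivative uxx' (x, y)) (at x) \<and>
         ((\<lambda>t. snd (G' (x, t))) has_real_derivative uyy' (x, y)) (at y)"
      "continuous_on (Omega x0 y0) uxx'" "continuous_on (Omega x0 y0) uyy'"
      "\<And>z. z\<in>Omega x0 y0 \<Longrightarrow> - (uxx' z + uyy' z) = g'"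
      "\<And>z. z\<in>{0} \<times> {0<..y0} \<Longrightarrow> - (G' z \<bullet> (-1, 0)) = \<alpha> * (u' z - b')"
      "\<And>z. z\<in>{x0} \<times> {0<..y0} \<Longrightarrow> - (G' z \<bullet> (1, 0)) = q'"
      "\<And>z. z\<in>{0..x0} \<times> {0} \<Longrightarrow> - (G' z \<bullet> (0, -1)) = 0"
      "\<And>z. z\<in>{0..x0} \<times> {y0} \<Longrightarrow> - (G' z \<bullet> (0, 1)) = 0"
    using assms(2) unfolding solves_S_def by fast
  show ?thesis
    unfolding solves_S_def
  proof (rule exI[of _ "\<lambda>z. G z - G' z"], rule exI[of _ "\<lambda>z. uxx z - uxx' z"],
      rule exI[of _ "\<lambda>z. uyy z - uyy' z"], intro conjI ballI)
    fix z assume z: "z \<in> ?K"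
    show "((\<lambda>z. u z - u' z) has_derivative (\<lambda>v. (G z - G' z) \<bullet> v)) (at z within ?K)"
      using has_derivative_diff[OF G(1)[OF z] G'(1)[OF z]] by (simp add: inner_diff_left)
  next
    show "continuous_on ?K (\<lambda>z. G z - G' z)"
      "continuous_on (Omega x0 y0) (\<lambda>z. uxx z - uxx' z)"
      "continuous_on (Omega x0 y0) (\<lambda>z. uyy z - uyy' z)"
      by (intro continuous_intros G G')+
  next
    fix z assume "z \<in> Omega x0 y0"
    then show "case z of (x, y) \<Rightarrow>
         ((\<lambda>s. fst (G (s, y) - G' (s, y))) has_real_derivative uxx (x, y) - uxx' (x, y)) (at x) \<and>
         ((\<lambda>t. snd (G (x, t) - G' (x, t))) has_real_derivative uyy (x, y) - uyy' (x, y)) (at y)"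
      using G(3) G'(3) by (auto intro!: DERIV_diff simp: fst_diff snd_diff)
  next
    fix z assume "z \<in> Omega x0 y0"
    then show "- (uxx z - uxx' z + (uyy z - uyy' z)) = g - g'"
      using G(6)[of z] G'(6)[of z] by simp
  next
    fix z assume "z \<in> {x0} \<times> {0<..y0}"
    then show "- ((G z - G' z) \<bullet> (1, 0)) = q - q'"
      using G(8)[OF \<open>z \<in> _\<close>] G'(8)[OF \<open>z \<in> _\<close>] by (simp only: inner_diff_left)
  qed (use G(7,9,10) G'(7,9,10) in \<open>auto simp: inner_diff_left algebra_simps\<close>)
qed

text \<open>
  A maximum principle with a barrier. The function \<open>\<phi>\<close> below is strictly subharmonic
  (\<open>\<Delta>\<phi> = 4 - 2\<close>) and has negative outward normal derivative on the three Neumann sides. Adding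
  \<open>\<epsilon> \<phi>\<close> to \<open>w\<close> therefore excludes a maximum in the interior and on these sides, corners included.
  The maximum lies on the Robin side, where \<open>\<partial>w/\<partial>x = \<alpha> w\<close> bounds \<open>w\<close> by a multiple of \<open>\<epsilon>\<close>.
  The second derivatives of a classical solution need not be integrable up to the boundary, so an
  energy argument would require an exhaustion by smaller rectangles; a maximum principle works
  pointwise.
\<close>

lemma homogeneous_solution_nonpos:
  assumes pos: "x0 > 0" "y0 > 0" "\<alpha> > 0"
    and sol: "solves_S x0 y0 0 0 \<alpha> 0 w"
    and z0: "z0 \<in> {0..x0} \<times> {0..y0}"
  shows "w z0 \<le> 0"
proof -
  define K where "K = {0..x0} \<times> {0..y0}"
  obtain G wxx wyy where G:
      "\<forall>z\<in>K. (w has_derivative (\<lambda>v. G z \<bullet> v)) (at z within K)"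
      "\<forall>(x, y)\<in>Omega x0 y0.
         ((\<lambda>s. fst (G (s, y))) has_real_derivative wxx (x, y)) (at x) \<and>
         ((\<lambda>t. snd (G (x, t))) has_real_derivative wyy (x, y)) (at y)"
      "\<forall>z\<in>Omega x0 y0. - (wxx z + wyy z) = 0"
      "\<forall>z\<in>{0} \<times> {0<..y0}. - (G z \<bullet> (-1, 0)) = \<alpha> * (w z - 0)"
      "\<forall>z\<in>{x0} \<times> {0<..y0}. - (G z \<bullet> (1, 0)) = 0"
      "\<forall>z\<in>{0..x0} \<times> {0}. - (G z \<bullet> (0, -1)) = 0"
      "\<forall>z\<in>{0..x0} \<times> {y0}. - (G z \<bullet> (0, 1)) = 0"
    using sol unfolding solves_S_def K_def by fast
  have dw: "(w has_derivative (\<lambda>v. G z \<bullet> v)) (at z within K)" if "z \<in> K" for z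
    using G(1) that by blast
  have d2w: "((\<lambda>s. fst (G (s, y))) has_real_derivative wxx (x, y)) (at x) \<and>
      ((\<lambda>t. snd (G (x, t))) has_real_derivative wyy (x, y)) (at y)"
    if "(x, y) \<in> Omega x0 y0" for x y
    using G(2) that by blast
  have harmonic: "wxx z + wyy z = 0" if "z \<in> Omega x0 y0" for z
    using G(3) that by (metis neg_equal_0_iff_equal)
  have left: "fst (G (0, y)) = \<alpha> * w (0, y)" if "0 < y" "y \<le> y0" for y
    using bspec[OF G(4), of "(0, y)"] that by (simp add: inner_prod_def)
  have right: "fst (G (x0, y)) = 0" if "0 < y" "y \<le> y0" for y
    using bspec[OF G(5), of "(x0, y)"] that by (simp add: inner_prod_def)
  have bottom: "snd (G (x, 0)) = 0" if "0 \<le> x" "x \<le> x0" for x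
    using bspec[OF G(6), of "(x, 0)"] that by (simp add: inner_prod_def)
  have top: "snd (G (x, y0)) = 0" if "0 \<le> x" "x \<le> x0" for x
    using bspec[OF G(7), of "(x, y0)"] that by (simp add: inner_prod_def)
  define \<phi> where "\<phi> = (\<lambda>z::real \<times> real. 2 * (fst z - x0 - 1)\<^sup>2 - (snd z - y0 / 2)\<^sup>2)"
  define C where "C = 4 * (x0 + 1) / \<alpha> + 2 * (x0 + 1)\<^sup>2 + y0\<^sup>2"
  have bound: "w z0 \<le> \<epsilon> * C" if \<epsilon>: "\<epsilon> > 0" for \<epsilon>
  proof -
    define v where "v = (\<lambda>z. w z + \<epsilon> * \<phi> z)"
    define Gv where
      "Gv = (\<lambda>z. G z + \<epsilon> *\<^sub>R (4 * (fst z - x0 - 1), - 2 * (snd z - y0 / 2)))"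
    have dv: "(v has_derivative (\<lambda>d. Gv z \<bullet> d)) (at z within K)" if "z \<in> K" for z
      unfolding v_def \<phi>_def
      by (rule derivative_eq_intros dw that refl)+
         (auto simp: Gv_def inner_prod_def algebra_simps)
    have K: "compact K" "convex K" "K \<noteq> {}"
      using z0 by (auto simp: K_def compact_Times convex_Times)
    have "continuous_on K v"
      using dv by (meson has_derivative_continuous_on)
    then obtain p where p: "p \<in> K" "\<And>z. z \<in> K \<Longrightarrow> v z \<le> v p"
      using continuous_attains_sup[OF K(1,3)] by blast
    obtain x y where xy: "p = (x, y)" "0 \<le> x" "x \<le> x0" "0 \<le> y" "y \<le> y0"
      using p(1) by (auto simp: K_def)
    have slope: "Gv p \<bullet> d \<le> 0" if "p + d \<in> K" for d
      by (rule directional_derivative_nonpos_at_max[OF K(2) p(1) that dv[OF p(1)] p(2)])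
    \<comment> \<open>Top and bottom come first: the Neumann condition there holds on the closed sides, whereas
      the conditions on the vertical sides are only given for \<open>y > 0\<close>.\<close>
    have "y \<noteq> 0"
      using slope[of "(0, y0)"] bottom[of x] xy pos \<epsilon>
      by (auto simp: K_def Gv_def inner_prod_def mult_le_0_iff)
    moreover have "y \<noteq> y0"
      using slope[of "(0, - y0)"] top[of x] xy pos \<epsilon>
      by (auto simp: K_def Gv_def inner_prod_def mult_le_0_iff zero_le_mult_iff)
    ultimately have y: "0 < y" "y < y0" using xy by auto
    have "x \<noteq> x0"
      using slope[of "(- x0, 0)"] right[of y] xy y pos \<epsilon>
      by (auto simp: K_def Gv_def inner_prod_def mult_le_0_iff zero_le_mult_iff)
    moreover have "x = 0"
    proof (rule ccontr)
      assume "x \<noteq> 0"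
      with \<open>x \<noteq> x0\<close> xy have x: "0 < x" "x < x0" by auto
      have int: "Omega x0 y0 \<subseteq> interior K"
        by (auto simp: K_def Omega_def interior_Times)
      have dvi: "(v has_derivative (\<lambda>d. Gv z \<bullet> d)) (at z)" if "z \<in> Omega x0 y0" for z
        using dv[of z] that int at_within_interior[of z K] interior_subset[of K] by (metis subsetD)
      have pO: "(x, y) \<in> Omega x0 y0" using x y by (simp add: Omega_def)
      have "wxx (x, y) + 4 * \<epsilon> \<le> 0"
      proof (rule second_derivative_nonpos_at_local_max[where f = "\<lambda>s. v (s, y)"
            and f' = "\<lambda>s. fst (Gv (s, y))" and x = x])
        have "\<forall>\<^sub>F s in nhds x. s \<in> {0<..<x0}"
          using x by (intro eventually_nhds_in_open) auto
        then show "\<forall>\<^sub>F s in nhds x. ((\<lambda>s. v (s, y)) has_real_derivative fst (Gv (s, y))) (at s)"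
        proof eventually_elim
          case (elim s)
          have "((\<lambda>s. v (s, y)) has_derivative (\<lambda>d. Gv (s, y) \<bullet> (d, 0))) (at s)"
            by (rule has_derivative_compose[where g = v and f = "\<lambda>s. (s, y)", OF _ dvi])
               (use elim y in \<open>auto simp: Omega_def intro!: derivative_eq_intros\<close>)
          then show ?case
            by (simp add: has_field_derivative_def inner_prod_def mult_commute_abs)
        qed
        show "\<forall>\<^sub>F s in nhds x. v (s, y) \<le> v (x, y)"
          using \<open>\<forall>\<^sub>F s in nhds x. s \<in> {0<..<x0}\<close>
          by eventually_elim (use p(2) xy in \<open>auto simp: K_def\<close>)
        show "((\<lambda>s. fst (Gv (s, y))) has_real_derivative wxx (x, y) + 4 * \<epsilon>) (at x)"
          unfolding Gv_def fst_add fst_scaleR fst_conv snd_conv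
          by (rule derivative_eq_intros conjunct1[OF d2w[OF pO]] refl)+ simp
      qed
      moreover have "wyy (x, y) - 2 * \<epsilon> \<le> 0"
      proof (rule second_derivative_nonpos_at_local_max[where f = "\<lambda>t. v (x, t)"
            and f' = "\<lambda>t. snd (Gv (x, t))" and x = y])
        have "\<forall>\<^sub>F t in nhds y. t \<in> {0<..<y0}"
          using y by (intro eventually_nhds_in_open) auto
        then show "\<forall>\<^sub>F t in nhds y. ((\<lambda>t. v (x, t)) has_real_derivative snd (Gv (x, t))) (at t)"
        proof eventually_elim
          case (elim t)
          have "((\<lambda>t. v (x, t)) has_derivative (\<lambda>d. Gv (x, t) \<bullet> (0, d))) (at t)"
            by (rule has_derivative_compose[where g = v and f = "\<lambda>t. (x, t)", OF _ dvi])
               (use elim x in \<open>auto simp: Omega_def intro!: derivative_eq_intros\<close>)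
          then show ?case
            by (simp add: has_field_derivative_def inner_prod_def mult_commute_abs)
        qed
        show "\<forall>\<^sub>F t in nhds y. v (x, t) \<le> v (x, y)"
          using \<open>\<forall>\<^sub>F t in nhds y. t \<in> {0<..<y0}\<close>
          by eventually_elim (use p(2) xy in \<open>auto simp: K_def\<close>)
        show "((\<lambda>t. snd (Gv (x, t))) has_real_derivative wyy (x, y) - 2 * \<epsilon>) (at y)"
          unfolding Gv_def snd_add snd_scaleR fst_conv snd_conv
          by (rule derivative_eq_intros conjunct2[OF d2w[OF pO]] refl)+ simp
      qed
      ultimately show False using harmonic[OF pO] \<epsilon> by simp
    qed
    ultimately have "fst (Gv p) \<le> 0"
      using slope[of "(x0, 0)"] xy pos by (auto simp: K_def inner_prod_def mult_le_0_iff)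
    then have "\<alpha> * w p \<le> \<epsilon> * (4 * (x0 + 1))"
      using left[of y] y xy \<open>x = 0\<close> by (simp add: Gv_def algebra_simps)
    then have wp: "w p \<le> \<epsilon> * (4 * (x0 + 1) / \<alpha>)"
      using pos by (simp add: field_simps)
    have "(0 - x0 - 1)\<^sup>2 = (x0 + 1)\<^sup>2" by (simp add: power2_eq_square algebra_simps)
    then have "\<phi> p \<le> 2 * (x0 + 1)\<^sup>2"
      using xy \<open>x = 0\<close> by (simp add: \<phi>_def)
    then have "\<epsilon> * \<phi> p \<le> \<epsilon> * (2 * (x0 + 1)\<^sup>2)" using \<epsilon> by simp
    moreover have "- y0\<^sup>2 \<le> \<phi> z0"
    proof -
      have "\<bar>snd z0 - y0 / 2\<bar> \<le> \<bar>y0\<bar>" using z0 by auto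
      then have "(snd z0 - y0 / 2)\<^sup>2 \<le> y0\<^sup>2" by (simp add: abs_le_square_iff)
      moreover have "0 \<le> 2 * (fst z0 - x0 - 1)\<^sup>2" by simp
      ultimately show ?thesis unfolding \<phi>_def by linarith
    qed
    then have "\<epsilon> * (- y0\<^sup>2) \<le> \<epsilon> * \<phi> z0" using \<epsilon> by (intro mult_left_mono) auto
    moreover have "w z0 + \<epsilon> * \<phi> z0 \<le> w p + \<epsilon> * \<phi> p"
      using p(2)[of z0] z0 by (simp add: K_def v_def)
    ultimately show "w z0 \<le> \<epsilon> * C"
      using wp unfolding C_def by (simp add: distrib_left)
  qed
  have C: "C > 0" using pos by (auto simp: C_def intro!: add_pos_pos add_pos_nonneg)
  show ?thesis
  proof (rule field_le_epsilon)
    fix e :: real assume "e > 0"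
    then show "w z0 \<le> 0 + e" using bound[of "e / C"] C by simp
  qed
qed

lemma solves_S_unique:
  assumes "x0 > 0" "y0 > 0" "\<alpha> > 0"
    and "solves_S x0 y0 g q \<alpha> b u" and "solves_S x0 y0 g q \<alpha> b u'"
    and "z \<in> {0..x0} \<times> {0..y0}"
  shows "u z = u' z"
proof (rule antisym)
  show "u z \<le> u' z"
    using homogeneous_solution_nonpos[OF assms(1-3) _ assms(6), of "\<lambda>z. u z - u' z"]
      solves_S_diff[OF assms(4,5)] by simp
  show "u' z \<le> u z"
    using homogeneous_solution_nonpos[OF assms(1-3) _ assms(6), of "\<lambda>z. u' z - u z"]
      solves_S_diff[OF assms(5,4)] by simp
qed

section \<open>Integration over the rectangle\<close>

lemma Omega_eq_box: "Omega x0 y0 = box (0, 0) (x0, y0)"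
  by (simp add: Omega_def box_prod)

lemma Omega_sets [measurable, simp]: "Omega x0 y0 \<in> sets borel"
  by (simp add: Omega_eq_box)

lemma emeasure_Omega:
  assumes "x0 > 0" "y0 > 0"
  shows "emeasure lborel (Omega x0 y0) = ennreal (x0 * y0)"
  unfolding Omega_def
  using assms by (simp add: lborel_prod[symmetric] lborel.emeasure_pair_measure_Times ennreal_mult)

lemma measure_Omega:
  assumes "x0 > 0" "y0 > 0"
  shows "measure lborel (Omega x0 y0) = x0 * y0"
  using emeasure_Omega[OF assms] assms by (simp add: measure_def)

lemma set_integrable_Omega:
  assumes "x0 > 0" "y0 > 0" and "f \<in> borel_measurable borel"
    and "\<And>z. z \<in> Omega x0 y0 \<Longrightarrow> \<bar>f z\<bar> \<le> C"
  shows "set_integrable lborel (Omega x0 y0) (f :: _ \<Rightarrow> real)"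
proof (rule set_integrable_bound[where f = "\<lambda>_. C"])
  show "set_integrable lborel (Omega x0 y0) (\<lambda>_. C)"
    unfolding set_integrable_def
    using emeasure_Omega[OF assms(1,2)] by (auto simp: less_top)
  show "set_borel_measurable lborel (Omega x0 y0) f"
    unfolding set_borel_measurable_def using assms(3) by measurable
qed (use assms(4) in fastforce)

lemma set_integral_const_Omega:
  assumes "x0 > 0" "y0 > 0"
  shows "(LINT z:Omega x0 y0|lborel. (c::real)) = x0 * y0 * c"
  using measure_Omega[OF assms] by (simp add: set_lebesgue_integral_def)

lemma abs_set_integral_Omega_le:
  assumes "x0 > 0" "y0 > 0" and "f \<in> borel_measurable borel"
    and "\<And>z. z \<in> Omega x0 y0 \<Longrightarrow> \<bar>f z\<bar> \<le> C"
  shows "\<bar>LINT z:Omega x0 y0|lborel. (f z :: real)\<bar> \<le> x0 * y0 * C"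
proof -
  have f: "set_integrable lborel (Omega x0 y0) f" by (rule set_integrable_Omega[OF assms])
  have "\<bar>LINT z:Omega x0 y0|lborel. f z\<bar> \<le> (LINT z:Omega x0 y0|lborel. \<bar>f z\<bar>)"
    using set_integral_norm_bound[OF f] by simp
  also have "\<dots> \<le> (LINT z:Omega x0 y0|lborel. C)"
    using assms(4) by (intro set_integral_mono set_integrable_abs f
        set_integrable_Omega[OF assms(1,2), where C = "\<bar>C\<bar>"]) auto
  finally show ?thesis by (simp add: set_integral_const_Omega[OF assms(1,2)])
qed

lemma set_integral_Omega_fst:
  assumes "x0 > 0" "y0 > 0" and [measurable]: "\<psi> \<in> borel_measurable borel"
    and bound: "\<And>x. x \<in> {0<..<x0} \<Longrightarrow> \<bar>\<psi> x\<bar> \<le> C"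
  shows "(LINT z:Omega x0 y0|lborel. (\<psi> (fst z) :: real)) = y0 * (LINT x:{0<..<x0}|lborel. \<psi> x)"
proof -
  have "set_integrable lborel (Omega x0 y0) (\<lambda>z. \<psi> (fst z))"
    by (rule set_integrable_Omega[OF assms(1,2), where C = C])
       (auto simp: Omega_def bound simp flip: borel_prod)
  then have "integrable (lborel \<Otimes>\<^sub>M lborel) (\<lambda>z. indicator (Omega x0 y0) z *\<^sub>R \<psi> (fst z))"
    by (simp add: set_integrable_def lborel_prod)
  from lborel_pair.integral_fst'[OF this]
  have "(LINT z:Omega x0 y0|lborel. \<psi> (fst z)) =
      (LINT x|lborel. LINT y|lborel. indicator (Omega x0 y0) (x, y) *\<^sub>R \<psi> x)"
    by (simp add: set_lebesgue_integral_def lborel_prod)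
  also have "\<dots> = (LINT x|lborel. LINT y|lborel. (indicator {0<..<x0} x * \<psi> x) * indicator {0<..<y0} y)"
    by (intro Bochner_Integration.integral_cong) (auto simp: Omega_def indicator_def)
  also have "\<dots> = (LINT x|lborel. y0 * (indicator {0<..<x0} x * \<psi> x))"
    using assms(2) by (simp add: mult.commute)
  finally show ?thesis by (simp add: set_lebesgue_integral_def)
qed

lemma norm_H_cong:
  assumes "\<And>z. z \<in> Omega x0 y0 \<Longrightarrow> f z = f' z"
  shows "norm_H x0 y0 f = norm_H x0 y0 f'"
  unfolding norm_H_def using assms by (auto intro!: arg_cong[where f = sqrt] set_lebesgue_integral_cong)

lemma norm_H_cmult: "norm_H x0 y0 (\<lambda>z. c * f z) = \<bar>c\<bar> * norm_H x0 y0 f"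
  by (simp add: norm_H_def power_mult_distrib real_sqrt_mult)

lemma norm_H_square: "(norm_H x0 y0 f)\<^sup>2 = (LINT z:Omega x0 y0|lborel. (f z)\<^sup>2)"
  unfolding norm_H_def set_lebesgue_integral_def
  by (intro real_sqrt_pow2 Bochner_Integration.integral_nonneg) auto

text \<open>
  A pointwise expansion \<open>f n = h e + O(h\<^sup>2)\<close>, uniform on the rectangle, passes to the norm: the
  quotients \<open>f n / h\<close> converge to \<open>e\<close> boundedly, so their norms converge by dominated convergence.
\<close>

lemma norm_H_linear_rate:
  fixes f :: "nat \<Rightarrow> real \<times> real \<Rightarrow> real"
  assumes pos: "x0 > 0" "y0 > 0"
    and [measurable]: "\<And>n. f n \<in> borel_measurable borel" "e \<in> borel_measurable borel"
    and e: "\<And>z. z \<in> Omega x0 y0 \<Longrightarrow> \<bar>e z\<bar> \<le> K"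
    and C: "C \<ge> 0"
    and f: "\<And>n z. n \<ge> 1 \<Longrightarrow> z \<in> Omega x0 y0 \<Longrightarrow>
              \<bar>f n z - x0 / real n * e z\<bar> \<le> C * (x0 / real n)\<^sup>2"
  shows "(\<lambda>n. norm_H x0 y0 (f n) - norm_H x0 y0 e * (x0 / real n)) \<in> o(\<lambda>n. x0 / real n)"
proof -
  define h where "h n = x0 / real (Suc n)" for n
  define F where "F n z = f (Suc n) z / h n" for n z
  have h: "h n > 0" "h n \<le> x0" for n using pos by (auto simp: h_def field_simps)
  have h0: "h \<longlonglongrightarrow> 0" unfolding h_def by real_asymp
  have F: "\<bar>F n z - e z\<bar> \<le> C * h n" if "z \<in> Omega x0 y0" for n z
  proof -
    have "\<bar>F n z - e z\<bar> * h n = \<bar>(F n z - e z) * h n\<bar>" using h(1)[of n] by (simp add: abs_mult)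
    also have "(F n z - e z) * h n = f (Suc n) z - h n * e z"
      using h(1)[of n] by (simp add: F_def field_simps)
    also have "\<bar>\<dots>\<bar> \<le> C * h n * h n"
      using f[of "Suc n" z] that by (simp add: h_def power2_eq_square mult.assoc)
    finally show ?thesis using h(1)[of n] by simp
  qed
  have "(\<lambda>n. LINT z:Omega x0 y0|lborel. (F n z)\<^sup>2) \<longlonglongrightarrow> (LINT z:Omega x0 y0|lborel. (e z)\<^sup>2)"
    unfolding set_lebesgue_integral_def
  proof (rule integral_dominated_convergence)
    show "(\<lambda>z. indicator (Omega x0 y0) z *\<^sub>R (e z)\<^sup>2) \<in> borel_measurable lborel"
      "(\<lambda>z. indicator (Omega x0 y0) z *\<^sub>R (F n z)\<^sup>2) \<in> borel_measurable lborel" for n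
      unfolding F_def by measurable
    show "integrable lborel (\<lambda>z. indicator (Omega x0 y0) z *\<^sub>R (K + C * x0)\<^sup>2)"
      using set_integrable_Omega[OF pos, of "\<lambda>_. (K + C * x0)\<^sup>2"] by (auto simp: set_integrable_def)
    show "AE z in lborel. (\<lambda>n. indicator (Omega x0 y0) z *\<^sub>R (F n z)\<^sup>2)
        \<longlonglongrightarrow> indicator (Omega x0 y0) z *\<^sub>R (e z)\<^sup>2"
    proof (rule AE_I2)
      fix z
      have "(\<lambda>n. F n z) \<longlonglongrightarrow> e z" if "z \<in> Omega x0 y0"
      proof (rule LIM_zero_cancel, rule Lim_null_comparison)
        show "\<forall>\<^sub>F n in sequentially. norm (F n z - e z) \<le> C * h n" using F that by simp
        show "(\<lambda>n. C * h n) \<longlonglongrightarrow> 0" using h0 by (rule tendsto_mult_right_zero)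
      qed
      then show "(\<lambda>n. indicator (Omega x0 y0) z *\<^sub>R (F n z)\<^sup>2)
          \<longlonglongrightarrow> indicator (Omega x0 y0) z *\<^sub>R (e z)\<^sup>2"
        by (cases "z \<in> Omega x0 y0") (auto intro!: tendsto_intros)
    qed
    show "AE z in lborel. norm (indicator (Omega x0 y0) z *\<^sub>R (F n z)\<^sup>2)
        \<le> indicator (Omega x0 y0) z *\<^sub>R (K + C * x0)\<^sup>2" for n
    proof (rule AE_I2)
      fix z
      have "(F n z)\<^sup>2 \<le> (K + C * x0)\<^sup>2" if "z \<in> Omega x0 y0"
      proof (rule abs_le_square_iff[THEN iffD1])
        have "C * h n \<le> C * x0" using C h by (simp add: mult_left_mono)
        then show "\<bar>F n z\<bar> \<le> \<bar>K + C * x0\<bar>" using F[OF that, of n] e[OF that] by linarith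
      qed
      then show "norm (indicator (Omega x0 y0) z *\<^sub>R (F n z)\<^sup>2)
        \<le> indicator (Omega x0 y0) z *\<^sub>R (K + C * x0)\<^sup>2"
        by (auto simp: indicator_def)
    qed
  qed
  then have "(\<lambda>n. norm_H x0 y0 (F n)) \<longlonglongrightarrow> norm_H x0 y0 e"
    unfolding norm_H_def by (rule tendsto_real_sqrt)
  moreover have "norm_H x0 y0 (F n) = norm_H x0 y0 (f (Suc n)) / (x0 / real (Suc n))" for n
  proof -
    have "F n = (\<lambda>z. 1 / h n * f (Suc n) z)" by (simp add: F_def fun_eq_iff)
    then show ?thesis using norm_H_cmult[of x0 y0 "1 / h n" "f (Suc n)"] h(1)[of n]
      using pos by (simp add: h_def mult.commute)
  qed
  ultimately have "(\<lambda>n. norm_H x0 y0 (f n) / (x0 / real n)) \<longlonglongrightarrow> norm_H x0 y0 e"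
    by (subst filterlim_sequentially_Suc[symmetric]) simp
  then have "(\<lambda>n. norm_H x0 y0 (f n) / (x0 / real n) - norm_H x0 y0 e) \<longlonglongrightarrow> 0"
    by (simp add: LIM_zero)
  moreover have ev: "\<forall>\<^sub>F n in sequentially. x0 / real n \<noteq> 0"
    using eventually_gt_at_top[of 0] by eventually_elim (use pos in auto)
  then have "\<forall>\<^sub>F n in sequentially. norm_H x0 y0 (f n) / (x0 / real n) - norm_H x0 y0 e =
      (norm_H x0 y0 (f n) - norm_H x0 y0 e * (x0 / real n)) / (x0 / real n)"
    by eventually_elim (simp add: field_simps)
  ultimately show ?thesis
    by (intro smalloI_tendsto[OF _ ev]) (simp add: tendsto_cong)
qed

section \<open>Minimizers of the cost\<close>

text \<open>
  The control enters the state additively, so the cost is a quadratic polynomial in it with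
  leading coefficient \<open>(x0 y0 + M3 y0) / 2 > 0\<close>; the equation is the vanishing of its derivative.
  It holds for the continuous and the discrete state alike, which makes the two minimizers
  comparable through the integral of the difference of the states.
\<close>

lemma cost_minimizer:
  assumes pos: "x0 > 0" "y0 > 0" "M3 > 0"
    and [measurable]: "f \<in> borel_measurable borel"
    and bound: "\<And>z. z \<in> Omega x0 y0 \<Longrightarrow> \<bar>f z\<bar> \<le> C"
    and S: "\<And>b z. z \<in> Omega x0 y0 \<Longrightarrow> S b z = f z + b"
    and min: "is_arg_min (cost x0 y0 M3 zd S) (\<lambda>_. True) b"
  shows "b * (x0 * y0 + M3 * y0) = - (LINT z:Omega x0 y0|lborel. f z - zd)"
proof -
  define I where "I = (LINT z:Omega x0 y0|lborel. f z - zd)"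
  define A where "A = x0 * y0 + M3 * y0"
  have A: "A > 0" using pos by (simp add: A_def add_pos_pos)
  have bound': "\<bar>f z - zd\<bar> \<le> C + \<bar>zd\<bar>" if "z \<in> Omega x0 y0" for z
    using bound[OF that] by linarith
  have int1: "set_integrable lborel (Omega x0 y0) (\<lambda>z. f z - zd)"
    by (rule set_integrable_Omega[OF pos(1,2) _ bound']) measurable
  have int2: "set_integrable lborel (Omega x0 y0) (\<lambda>z. (f z - zd)\<^sup>2)"
  proof (rule set_integrable_Omega[OF pos(1,2)])
    show "\<bar>(f z - zd)\<^sup>2\<bar> \<le> (C + \<bar>zd\<bar>)\<^sup>2" if "z \<in> Omega x0 y0" for z
      using power_mono[OF bound'[OF that], of 2] by simp
  qed measurable
  have int0: "set_integrable lborel (Omega x0 y0) (\<lambda>_. k)" for k :: real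
    by (rule set_integrable_Omega[OF pos(1,2), where C = "\<bar>k\<bar>"]) auto
  have cost: "cost x0 y0 M3 zd S c =
      1/2 * (LINT z:Omega x0 y0|lborel. (f z - zd)\<^sup>2) + I * c + A / 2 * c\<^sup>2" for c
  proof -
    have "(LINT z:Omega x0 y0|lborel. (S c z - zd)\<^sup>2) =
        (LINT z:Omega x0 y0|lborel. (f z - zd)\<^sup>2 + (2 * c * (f z - zd) + c\<^sup>2))"
      by (rule set_lebesgue_integral_cong) (auto simp: S power2_eq_square algebra_simps)
    also have "\<dots> = (LINT z:Omega x0 y0|lborel. (f z - zd)\<^sup>2) + (2 * c * I + x0 * y0 * c\<^sup>2)"
      using int0 int1 int2 set_integral_const_Omega[OF pos(1,2)]
      by (simp add: set_integral_add I_def)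
    finally show ?thesis
      using pos unfolding cost_def norm_H_square norm_B_def
      by (simp add: A_def field_simps)
  qed
  have "cost x0 y0 M3 zd S b \<le> cost x0 y0 M3 zd S (- I / A)"
    using min by (auto simp: is_arg_min_def not_less)
  moreover have "cost x0 y0 M3 zd S b - cost x0 y0 M3 zd S (- I / A) = A / 2 * (b + I / A)\<^sup>2"
    using A unfolding cost by (simp add: field_simps power2_eq_square)
  ultimately have "A / 2 * (b + I / A)\<^sup>2 \<le> 0" by simp
  then have "b + I / A = 0" using A by (simp add: mult_le_0_iff)
  then have "b * A = - I" using A by (simp add: field_simps)
  then show ?thesis by (simp only: A_def I_def)
qed

section \<open>Discretization error of the state\<close>

definition exact_sol ::
  "real \<Rightarrow> real \<Rightarrow> real \<Rightarrow> real \<Rightarrow> real \<Rightarrow> real \<times> real \<Rightarrow> real" where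
  "exact_sol x0 g q \<alpha> b = (\<lambda>(x, y).
     - (1/2) * g * x\<^sup>2 + (g * x0 - q) * x + (1/\<alpha>) * (g * x0 - q) + b)"

lemma solves_S_exact_sol:
  assumes "\<alpha> > 0"
  shows "solves_S x0 y0 g q \<alpha> b (exact_sol x0 g q \<alpha> b)"
  unfolding exact_sol_def by (rule solves_S_explicit[OF assms])

lemma real_cell: "real (cell h x) = max 1 (of_int \<lceil>x / h\<rceil>)"
proof (cases "1 \<le> \<lceil>x / h\<rceil>")
  case True
  then have "nat \<lceil>x / h\<rceil> \<ge> 1" "real (nat \<lceil>x / h\<rceil>) = of_int \<lceil>x / h\<rceil>" by linarith+
  then show ?thesis unfolding cell_def of_nat_max by simp
next
  case False
  then have "nat \<lceil>x / h\<rceil> = 0" "real_of_int \<lceil>x / h\<rceil> \<le> 1" by linarith+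
  then show ?thesis unfolding cell_def by simp
qed

lemma cell_bounds:
  assumes "h > 0" "x > 0"
  shows "x \<le> h * real (cell h x)" "h * real (cell h x) < x + h"
proof -
  have "x / h > 0" using assms by simp
  then have "\<lceil>x / h\<rceil> \<ge> 1" by linarith
  then have c: "real (cell h x) = of_int \<lceil>x / h\<rceil>" unfolding real_cell by simp
  have "x / h \<le> real (cell h x)" "real (cell h x) < x / h + 1" unfolding c by linarith+
  then show "x \<le> h * real (cell h x)" "h * real (cell h x) < x + h"
    using assms by (simp_all add: field_simps)
qed

lemma cell_measurable [measurable]: "(\<lambda>x. real (cell h x)) \<in> borel_measurable borel"
  unfolding real_cell by measurable

text \<open>
  Let \<open>r = i h - x \<in> [0, h]\<close> be the distance from \<open>x\<close> to the right end of its cell, the \<open>i\<close>-th.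
  Once the difference of the controls and the term linear in \<open>h\<close> are subtracted, exactly
  \<open>- (g / 2) r (h - r)\<close> remains.
\<close>

lemma discrete_error_expansion:
  assumes "x0 > 0" "n \<ge> 1" "z \<in> Omega x0 y0"
  shows "\<bar>discrete_sol x0 g q \<alpha> n b z - exact_sol x0 g q \<alpha> b' z - (b - b')
      - x0 / real n * (- g * (fst z / 2 + 1 / \<alpha>))\<bar> \<le> \<bar>g\<bar> * (x0 / real n)\<^sup>2"
proof -
  define h where "h = x0 / real n"
  obtain x y where z: "z = (x, y)" "x > 0" using assms(3) by (auto simp: Omega_def)
  define i where "i = real (cell h x)"
  define r where "r = h * i - x"
  have h: "h > 0" using assms by (simp add: h_def)
  have r: "0 \<le> r" "r \<le> h" using cell_bounds[OF h z(2)] by (auto simp: r_def i_def)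
  have "discrete_sol x0 g q \<alpha> n b z - exact_sol x0 g q \<alpha> b' z - (b - b')
      - h * (- g * (fst z / 2 + 1 / \<alpha>)) = - (g / 2) * (r * (h - r))"
    by (simp add: z discrete_sol_def exact_sol_def Let_def h_def[symmetric] i_def[symmetric] r_def
        diff_divide_distrib add_divide_distrib algebra_simps power2_eq_square)
  moreover have "\<bar>- (g / 2) * (r * (h - r))\<bar> = \<bar>g\<bar> * (r * (h - r) / 2)"
    using r by (simp add: abs_mult)
  moreover have "r * (h - r) \<le> h * h" using r by (intro mult_mono) auto
  with r have "r * (h - r) / 2 \<le> h\<^sup>2"
    by (simp add: power2_eq_square) (smt (verit) mult_nonneg_nonneg)
  then have "\<bar>g\<bar> * (r * (h - r) / 2) \<le> \<bar>g\<bar> * h\<^sup>2"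
    by (intro mult_left_mono) auto
  ultimately show ?thesis by (simp add: h_def)
qed

lemma discrete_sol_measurable [measurable]: "discrete_sol x0 g q \<alpha> n b \<in> borel_measurable borel"
  unfolding discrete_sol_def Let_def case_prod_unfold borel_prod[symmetric] by measurable

lemma exact_sol_measurable [measurable]: "exact_sol x0 g q \<alpha> b \<in> borel_measurable borel"
  unfolding exact_sol_def case_prod_unfold borel_prod[symmetric] by measurable

lemma exact_sol_bounded:
  assumes "z \<in> Omega x0 y0"
  shows "\<bar>exact_sol x0 g q \<alpha> b z\<bar> \<le> \<bar>g\<bar> * x0\<^sup>2 + \<bar>g * x0 - q\<bar> * x0 + \<bar>(g * x0 - q) / \<alpha> + b\<bar>"
proof -
  obtain x y where z: "z = (x, y)" "0 < x" "x < x0" using assms by (auto simp: Omega_def)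
  have "\<bar>1/2 * g * x\<^sup>2\<bar> \<le> \<bar>g\<bar> * x0\<^sup>2"
    unfolding abs_mult using z by (intro mult_mono) (auto intro: power_mono)
  moreover have "\<bar>(g * x0 - q) * x\<bar> \<le> \<bar>g * x0 - q\<bar> * x0"
    unfolding abs_mult using z by (intro mult_mono) auto
  ultimately show ?thesis by (simp add: z exact_sol_def)
qed

lemma error_profile_bounded:
  assumes "\<alpha> > 0" "z \<in> Omega x0 y0"
  shows "\<bar>- g * (fst z / 2 + 1 / \<alpha>)\<bar> \<le> \<bar>g\<bar> * (x0 / 2 + 1 / \<alpha>)"
proof -
  have "0 < fst z" "fst z < x0" using assms(2) by (auto simp: Omega_def)
  then have "\<bar>fst z / 2 + 1 / \<alpha>\<bar> \<le> x0 / 2 + 1 / \<alpha>" using assms(1) by simp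
  then show ?thesis unfolding abs_mult abs_minus by (rule mult_left_mono) simp
qed

section \<open>Discretization error of the derivative\<close>

text \<open>
  On the \<open>i\<close>-th cell the function is \<open>(x - i h)\<^sup>2\<close>, with the possible exception of the left node,
  and each cell contributes \<open>h\<^sup>3 / 3\<close>.
\<close>

lemma sawtooth_square_has_integral:
  assumes h: "h > 0"
  shows "((\<lambda>x. (x - h * real (cell h x))\<^sup>2) has_integral real k * (h ^ 3 / 3)) {0..real k * h}"
proof (induction k)
  case 0
  show ?case using has_integral_refl(2)[of _ "0::real"] by simp
next
  case (Suc k)
  have "((\<lambda>x. (x - real (Suc k) * h)\<^sup>2) has_integral
      (real (Suc k) * h - real (Suc k) * h) ^ 3 / 3 - (real k * h - real (Suc k) * h) ^ 3 / 3)
      {real k * h..real (Suc k) * h}"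
    using h by (intro fundamental_theorem_of_calculus)
      (auto intro!: derivative_eq_intros
        simp flip: has_real_derivative_iff_has_vector_derivative simp: algebra_simps)
  also have "(real (Suc k) * h - real (Suc k) * h) ^ 3 / 3 - (real k * h - real (Suc k) * h) ^ 3 / 3
      = h ^ 3 / 3"
    by (simp add: algebra_simps)
  finally have "((\<lambda>x. (x - h * real (cell h x))\<^sup>2) has_integral h ^ 3 / 3)
      {real k * h..real (Suc k) * h}"
  proof (rule has_integral_spike_finite[rotated 2])
    show "finite {real k * h}" by simp
    fix x assume "x \<in> {real k * h..real (Suc k) * h} - {real k * h}"
    then have "real k < x / h" "x / h \<le> real (Suc k)" using h by (auto simp: field_simps)
    then have "\<lceil>x / h\<rceil> = int (Suc k)" by (simp add: ceiling_eq_iff)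
    then have "cell h x = Suc k" unfolding cell_def by simp
    then show "(x - h * real (cell h x))\<^sup>2 = (x - real (Suc k) * h)\<^sup>2" by (simp add: mult.commute)
  qed
  from has_integral_combine[OF _ _ Suc.IH this] h show ?case
    by (simp add: field_simps)
qed

lemma ddx_discrete_sol:
  assumes "h = x0 / real n" "h > 0" "x \<notin> range (\<lambda>k::int. of_int k * h)"
  shows "ddx (discrete_sol x0 g q \<alpha> n b) (x, y) = g * x0 - q - h * g * real (cell h x)"
proof -
  define i where "i = real (cell h x)"
  have nint: "x / h \<noteq> of_int k" for k
    using assms(2,3) by (auto simp: field_simps)
  have lt: "of_int \<lceil>x / h\<rceil> - 1 < x / h" "x / h < of_int \<lceil>x / h\<rceil>"
    using nint[of "\<lceil>x / h\<rceil>"] by linarith+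
  have "\<forall>\<^sub>F s in nhds x. s \<in> {(of_int \<lceil>x / h\<rceil> - 1) * h <..< of_int \<lceil>x / h\<rceil> * h}"
    using lt assms(2) by (intro eventually_nhds_in_open) (auto simp: field_simps)
  then have "\<forall>\<^sub>F s in nhds x. discrete_sol x0 g q \<alpha> n b (s, y) =
      (g * x0 - q - h * g * i) * s + b + (g * x0 - q) / \<alpha> - g * h / \<alpha> + (i\<^sup>2 - i) / 2 * g * h\<^sup>2"
  proof eventually_elim
    case (elim s)
    then have "of_int \<lceil>x / h\<rceil> - 1 < s / h" "s / h \<le> of_int \<lceil>x / h\<rceil>"
      using assms(2) by (auto simp: field_simps)
    then have "\<lceil>s / h\<rceil> = \<lceil>x / h\<rceil>" by (simp add: ceiling_eq_iff)
    then have "cell h s = cell h x" by (simp add: cell_def)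
    then show ?case by (simp add: discrete_sol_def Let_def assms(1)[symmetric] i_def)
  qed
  then have "deriv (\<lambda>s. discrete_sol x0 g q \<alpha> n b (s, y)) x = deriv (\<lambda>s.
      (g * x0 - q - h * g * i) * s + b + (g * x0 - q) / \<alpha> - g * h / \<alpha> + (i\<^sup>2 - i) / 2 * g * h\<^sup>2) x"
    by (rule deriv_cong_ev) simp
  also have "\<dots> = g * x0 - q - h * g * i"
    by (rule DERIV_imp_deriv) (auto intro!: derivative_eq_intros)
  finally show ?thesis by (simp add: ddx_def i_def)
qed

lemma ddx_exact_sol: "ddx (exact_sol x0 g q \<alpha> b) (x, y) = - g * x + (g * x0 - q)"
  unfolding ddx_def exact_sol_def prod.case
  by (rule DERIV_imp_deriv) (auto intro!: derivative_eq_intros)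

lemma ddx_cong_Omega:
  assumes "\<And>z. z \<in> Omega x0 y0 \<Longrightarrow> f z = f' z" and "z \<in> Omega x0 y0"
  shows "ddx f z = ddx f' z"
proof -
  obtain x y where z: "z = (x, y)" "x \<in> {0<..<x0}" "y \<in> {0<..<y0}"
    using assms(2) by (auto simp: Omega_def)
  have "\<forall>\<^sub>F s in nhds x. s \<in> {0<..<x0}" using z by (intro eventually_nhds_in_open) auto
  then have "\<forall>\<^sub>F s in nhds x. f (s, y) = f' (s, y)"
    by eventually_elim (use assms(1) z in \<open>auto simp: Omega_def\<close>)
  then show ?thesis unfolding z ddx_def prod.case by (rule deriv_cong_ev) simp
qed

text \<open>
  The error of the derivative is \<open>g (x - i h)\<close> off the nodes, a sawtooth whose quotient by \<open>h\<close>
  oscillates and has no pointwise limit. Its norm is computed exactly instead: it is a constant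
  multiple of \<open>h\<close>, without a remainder, and does not depend on the controls.
\<close>

lemma norm_H_ddx_error:
  assumes pos: "x0 > 0" "y0 > 0" and n: "n \<ge> 1"
  shows "norm_H x0 y0 (\<lambda>z. ddx (discrete_sol x0 g q \<alpha> n b) z - ddx (exact_sol x0 g q \<alpha> b') z)
    = \<bar>g\<bar> * sqrt (x0 * y0 / 3) * (x0 / real n)"
proof -
  define h where "h = x0 / real n"
  define X where "X = range (\<lambda>k::int. of_int k * h)"
  define D where "D x = ddx (discrete_sol x0 g q \<alpha> n b) (x, 0)" for x
  define \<psi> where "\<psi> x = (x - h * real (cell h x))\<^sup>2" for x
  have h: "h > 0" using assms by (simp add: h_def)
  have D_fst: "ddx (discrete_sol x0 g q \<alpha> n b) z = D (fst z)" for z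
    by (simp add: D_def ddx_def discrete_sol_def case_prod_unfold)
  have D: "D x = g * x0 - q - h * g * real (cell h x)" if "x \<notin> X" for x
    unfolding D_def using ddx_discrete_sol[OF h_def h] that by (simp add: X_def)
  \<comment> \<open>Nothing is known about \<open>deriv\<close> at the nodes, so measurability of \<open>D\<close> rests on their being
    countably many.\<close>
  have [measurable]: "D \<in> borel_measurable borel"
    by (rule measurable_discrete_difference[where X = X
          and f = "\<lambda>x. g * x0 - q - h * g * real (cell h x)"])
       (auto simp: D X_def)
  have [measurable]: "\<psi> \<in> borel_measurable borel" unfolding \<psi>_def by measurable
  have "X \<times> UNIV \<in> null_sets (lborel \<Otimes>\<^sub>M lborel :: (real \<times> real) measure)"
  proof -
    have "X \<in> null_sets lborel"
      unfolding X_def by (intro countable_imp_null_set_lborel) auto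
    then show ?thesis
      by (auto simp: null_sets_def lborel.emeasure_pair_measure_Times intro!: pair_measureI)
  qed
  then have null: "AE z in lborel. z \<notin> X \<times> (UNIV :: real set)"
    unfolding lborel_prod by (rule AE_not_in)
  have "(LINT z:Omega x0 y0|lborel. (D (fst z) - (- g * fst z + (g * x0 - q)))\<^sup>2)
      = (LINT z:Omega x0 y0|lborel. g\<^sup>2 * \<psi> (fst z))"
  proof (rule set_lebesgue_integral_cong_AE)
    show "AE z\<in>Omega x0 y0 in lborel. (D (fst z) - (- g * fst z + (g * x0 - q)))\<^sup>2 = g\<^sup>2 * \<psi> (fst z)"
      using null
    proof eventually_elim
      case (elim z)
      then have "D (fst z) - (- g * fst z + (g * x0 - q)) = g * (fst z - h * real (cell h (fst z)))"
        by (auto simp: D algebra_simps mem_Times_iff)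
      then show ?case by (simp add: \<psi>_def power_mult_distrib)
    qed
  qed (auto simp flip: borel_prod simp: Omega_def)
  also have "\<dots> = g\<^sup>2 * (y0 * (LINT x:{0<..<x0}|lborel. \<psi> x))"
  proof -
    have "\<bar>\<psi> x\<bar> \<le> h\<^sup>2" if "x \<in> {0<..<x0}" for x
      using cell_bounds[OF h, of x] that by (auto simp: \<psi>_def abs_le_square_iff[symmetric])
    then show ?thesis using set_integral_Omega_fst[OF pos, of \<psi> "h\<^sup>2"] by simp
  qed
  also have "(LINT x:{0<..<x0}|lborel. \<psi> x) = x0 * h\<^sup>2 / 3"
  proof -
    have "set_integrable lborel {0<..<x0} \<psi>"
    proof (rule set_integrable_bound[where f = "\<lambda>_. h\<^sup>2"])
      show "set_integrable lborel {0<..<x0} (\<lambda>_. h\<^sup>2)" using pos by (simp add: set_integrable_def)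
      show "set_borel_measurable lborel {0<..<x0} \<psi>" unfolding set_borel_measurable_def by measurable
      show "AE x in lborel. x \<in> {0<..<x0} \<longrightarrow> norm (\<psi> x) \<le> norm (h\<^sup>2)"
      proof (intro AE_I2 impI)
        fix x assume "x \<in> {0<..<x0}"
        then show "norm (\<psi> x) \<le> norm (h\<^sup>2)"
          using cell_bounds[OF h, of x] by (auto simp: \<psi>_def abs_le_square_iff[symmetric])
      qed
    qed
    then have "(LINT x:{0<..<x0}|lborel. \<psi> x) = integral {0<..<x0} \<psi>"
      by (rule set_borel_integral_eq_integral)
    also have "(\<psi> has_integral x0 * h\<^sup>2 / 3) {0<..<x0}"
      using sawtooth_square_has_integral[OF h, of n] n
      unfolding \<psi>_def[symmetric, abs_def] has_integral_Icc_iff_Ioo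
      by (simp add: h_def power3_eq_cube power2_eq_square mult.assoc)
    then have "integral {0<..<x0} \<psi> = x0 * h\<^sup>2 / 3" by (rule integral_unique)
    finally show ?thesis .
  qed
  also have "g\<^sup>2 * (y0 * (x0 * h\<^sup>2 / 3)) = (\<bar>g\<bar> * h)\<^sup>2 * (x0 * y0 / 3)"
    by (simp add: power_mult_distrib)
  finally have *: "(LINT z:Omega x0 y0|lborel. (D (fst z) - (- g * fst z + (g * x0 - q)))\<^sup>2) =
      (\<bar>g\<bar> * h)\<^sup>2 * (x0 * y0 / 3)" .
  have "ddx (exact_sol x0 g q \<alpha> b') z = - g * fst z + (g * x0 - q)" for z
    using ddx_exact_sol[of x0 g q \<alpha> b' "fst z" "snd z"] by simp
  then have "norm_H x0 y0 (\<lambda>z. ddx (discrete_sol x0 g q \<alpha> n b) z - ddx (exact_sol x0 g q \<alpha> b') z)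
      = sqrt ((\<bar>g\<bar> * h)\<^sup>2 * (x0 * y0 / 3))"
    unfolding norm_H_def D_fst * [symmetric] by (simp only:)
  also have "\<dots> = (\<bar>g\<bar> * h) * sqrt (x0 * y0 / 3)"
    using h by (simp only: real_sqrt_mult real_sqrt_abs) simp
  finally show ?thesis by (simp add: h_def)
qed

section \<open>Convergence of the optimal controls and states\<close>

text \<open>
  The optimality equations of the two costs have the same coefficient, so the difference of the
  minimizers is minus the integral of the state error for control \<open>0\<close>, divided by it; the
  remainder \<open>O(h\<^sup>2)\<close> of that error is integrated with the area \<open>x0 y0\<close>, which the coefficient
  dominates.
\<close>

lemma control_error_expansion:
  fixes \<kappa> :: real
  assumes pos: "x0 > 0" "y0 > 0" "M3 > 0" "\<alpha> > 0" and n: "n \<ge> 1"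
    and S: "\<And>b z. z \<in> Omega x0 y0 \<Longrightarrow> S b z = exact_sol x0 g q \<alpha> b z"
    and min: "is_arg_min (cost x0 y0 M3 zd S) (\<lambda>_. True) b"
    and min_h: "is_arg_min (cost x0 y0 M3 zd (discrete_sol x0 g q \<alpha> n)) (\<lambda>_. True) b'"
  defines "\<kappa> \<equiv> - (LINT z:Omega x0 y0|lborel. - g * (fst z / 2 + 1 / \<alpha>)) / (x0 * y0 + M3 * y0)"
  shows "\<bar>b' - b - x0 / real n * \<kappa>\<bar> \<le> \<bar>g\<bar> * (x0 / real n)\<^sup>2"
proof -
  define h where "h = x0 / real n"
  define A where "A = x0 * y0 + M3 * y0"
  define v where "v = exact_sol x0 g q \<alpha> 0"
  define vh where "vh = discrete_sol x0 g q \<alpha> n 0"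
  define d where "d z = - g * (fst z / 2 + 1 / \<alpha>)" for z :: "real \<times> real"
  have A: "A > 0" "x0 * y0 \<le> A" using pos by (auto simp: A_def intro: add_pos_pos)
  have h: "h > 0" using pos n by (simp add: h_def)
  have meas [measurable]: "v \<in> borel_measurable borel" "vh \<in> borel_measurable borel"
    "d \<in> borel_measurable borel"
    by (simp_all add: v_def vh_def) (simp add: d_def[abs_def] flip: borel_prod)
  have diff: "\<bar>vh z - v z - h * d z\<bar> \<le> \<bar>g\<bar> * h\<^sup>2" if "z \<in> Omega x0 y0" for z
    using discrete_error_expansion[OF pos(1) n that, of g q \<alpha> 0 0]
    by (simp add: v_def vh_def d_def h_def)
  obtain Cv where Cv: "\<And>z. z \<in> Omega x0 y0 \<Longrightarrow> \<bar>v z\<bar> \<le> Cv"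
    unfolding v_def using exact_sol_bounded by blast
  define Cd where "Cd = \<bar>g\<bar> * (x0 / 2 + 1 / \<alpha>)"
  have Cd: "\<bar>d z\<bar> \<le> Cd" if "z \<in> Omega x0 y0" for z
    unfolding d_def Cd_def using that pos by (intro error_profile_bounded)
  have Cvh: "\<bar>vh z\<bar> \<le> Cv + h * Cd + \<bar>g\<bar> * h\<^sup>2" if "z \<in> Omega x0 y0" for z
  proof -
    have "\<bar>h * d z\<bar> \<le> h * Cd" using Cd[OF that] h by (simp add: abs_mult)
    then show ?thesis using Cv[OF that] diff[OF that] by linarith
  qed
  have b: "b * A = - (LINT z:Omega x0 y0|lborel. v z - zd)"
    unfolding A_def by (rule cost_minimizer[OF pos(1-3) meas(1) Cv _ min]) (auto simp: S v_def exact_sol_def)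
  have b': "b' * A = - (LINT z:Omega x0 y0|lborel. vh z - zd)"
    unfolding A_def
    by (rule cost_minimizer[OF pos(1-3) meas(2) Cvh _ min_h])
       (auto simp: vh_def discrete_sol_def Let_def)
  have int: "set_integrable lborel (Omega x0 y0) v" "set_integrable lborel (Omega x0 y0) vh"
    "set_integrable lborel (Omega x0 y0) (\<lambda>z. h * d z)"
    "set_integrable lborel (Omega x0 y0) (\<lambda>z. zd)"
    using set_integrable_Omega[OF pos(1,2) _ Cv] set_integrable_Omega[OF pos(1,2) _ Cvh]
      set_integrable_Omega[OF pos(1,2) _ Cd] set_integrable_Omega[OF pos(1,2), of "\<lambda>_. zd" "\<bar>zd\<bar>"]
    by auto
  have "(b' - b) * A + h * (LINT z:Omega x0 y0|lborel. d z)
      = - (LINT z:Omega x0 y0|lborel. vh z - v z - h * d z)"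
    using int b b' by (simp add: set_integral_diff left_diff_distrib)
  moreover have "\<bar>LINT z:Omega x0 y0|lborel. vh z - v z - h * d z\<bar> \<le> x0 * y0 * (\<bar>g\<bar> * h\<^sup>2)"
    by (rule abs_set_integral_Omega_le[OF pos(1,2) _ diff]) measurable
  moreover have "x0 * y0 * (\<bar>g\<bar> * h\<^sup>2) \<le> A * (\<bar>g\<bar> * h\<^sup>2)"
    using A by (intro mult_right_mono) auto
  ultimately have "\<bar>(b' - b) * A + h * (LINT z:Omega x0 y0|lborel. d z)\<bar> \<le> A * (\<bar>g\<bar> * h\<^sup>2)"
    by linarith
  moreover have "(b' - b) * A + h * (LINT z:Omega x0 y0|lborel. d z) = A * (b' - b - h * \<kappa>)"
  proof -
    have "\<kappa> = - (LINT z:Omega x0 y0|lborel. d z) / A" by (simp only: \<kappa>_def d_def A_def)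
    then have "A * \<kappa> = - (LINT z:Omega x0 y0|lborel. d z)" using A(1) by simp
    have "A * (b' - b - h * \<kappa>) = (b' - b) * A - h * (A * \<kappa>)" by (simp add: algebra_simps)
    then show ?thesis using \<open>A * \<kappa> = _\<close> by simp
  qed
  ultimately show ?thesis using A(1) by (simp add: abs_mult h_def)
qed

theorem lemma20:
  fixes x0 y0 g q zd M3 \<alpha> :: real
    and u :: "real \<Rightarrow> real \<times> real \<Rightarrow> real"
    and b_op :: real and bh_op :: "nat \<Rightarrow> real"
  assumes "x0 > 0" and "y0 > 0" and "M3 > 0" and "\<alpha> > 0"
    and "\<And>b. solves_S x0 y0 g q \<alpha> b (u b)"
    and "is_arg_min (cost x0 y0 M3 zd u) (\<lambda>_. True) b_op"
    and "\<And>n. n \<ge> 1 \<Longrightarrow>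
           is_arg_min (cost x0 y0 M3 zd (discrete_sol x0 g q \<alpha> n)) (\<lambda>_. True) (bh_op n)"
  shows "\<exists>C15 C16 :: real.
    (\<lambda>n. norm_H x0 y0 (\<lambda>z. discrete_sol x0 g q \<alpha> n (bh_op n) z - u b_op z)
           - C15 * (x0 / real n)) \<in> o(\<lambda>n. x0 / real n) \<and>
    (\<lambda>n. norm_H x0 y0 (\<lambda>z. ddx (discrete_sol x0 g q \<alpha> n (bh_op n)) z - ddx (u b_op) z)
           - C16 * (x0 / real n)) \<in> o(\<lambda>n. x0 / real n)"
proof -
  have u: "u b z = exact_sol x0 g q \<alpha> b z" if "z \<in> Omega x0 y0" for b z
    by (rule solves_S_unique[OF assms(1,2,4) assms(5) solves_S_exact_sol[OF assms(4)]])
       (use that in \<open>auto simp: Omega_def\<close>)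
  define \<kappa> where
    "\<kappa> = - (LINT z:Omega x0 y0|lborel. - g * (fst z / 2 + 1 / \<alpha>)) / (x0 * y0 + M3 * y0)"
  define e where "e z = - g * (fst z / 2 + 1 / \<alpha>) + \<kappa>" for z :: "real \<times> real"
  define err where "err n z = discrete_sol x0 g q \<alpha> n (bh_op n) z - exact_sol x0 g q \<alpha> b_op z"
    for n z
  have control: "\<bar>bh_op n - b_op - x0 / real n * \<kappa>\<bar> \<le> \<bar>g\<bar> * (x0 / real n)\<^sup>2" if "n \<ge> 1" for n
    unfolding \<kappa>_def
    by (rule control_error_expansion[OF assms(1-4) that u assms(6) assms(7)[OF that]])
  have err: "\<bar>err n z - x0 / real n * e z\<bar> \<le> 2 * \<bar>g\<bar> * (x0 / real n)\<^sup>2"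
    if "n \<ge> 1" "z \<in> Omega x0 y0" for n z
  proof -
    \<comment> \<open>The error splits into the discretization error for equal controls and the error of the
      control.\<close>
    have "err n z - x0 / real n * e z =
        (discrete_sol x0 g q \<alpha> n (bh_op n) z - exact_sol x0 g q \<alpha> b_op z - (bh_op n - b_op)
          - x0 / real n * (- g * (fst z / 2 + 1 / \<alpha>)))
        + (bh_op n - b_op - x0 / real n * \<kappa>)"
      unfolding err_def e_def distrib_left by linarith
    also have "\<bar>\<dots>\<bar> \<le> \<bar>g\<bar> * (x0 / real n)\<^sup>2 + \<bar>g\<bar> * (x0 / real n)\<^sup>2"
      by (rule order_trans[OF abs_triangle_ineq
            add_mono[OF discrete_error_expansion[OF assms(1) that] control[OF that(1)]]])
    finally show ?thesis by simp
  qed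
  have rate: "(\<lambda>n. norm_H x0 y0 (err n) - norm_H x0 y0 e * (x0 / real n)) \<in> o(\<lambda>n. x0 / real n)"
  proof (rule norm_H_linear_rate[OF assms(1,2) _ _ _ _ err])
    show "err n \<in> borel_measurable borel" for n unfolding err_def by measurable
    show "e \<in> borel_measurable borel" unfolding e_def borel_prod[symmetric] by measurable
    show "\<bar>e z\<bar> \<le> \<bar>g\<bar> * (x0 / 2 + 1 / \<alpha>) + \<bar>\<kappa>\<bar>" if "z \<in> Omega x0 y0" for z
      using error_profile_bounded[OF assms(4) that, of g] unfolding e_def by linarith
  qed simp
  have err_norm: "norm_H x0 y0 (\<lambda>z. discrete_sol x0 g q \<alpha> n (bh_op n) z - u b_op z) =
      norm_H x0 y0 (err n)" for n
    by (rule norm_H_cong) (simp add: u err_def)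
  have ddx_rate: "(\<lambda>n. norm_H x0 y0 (\<lambda>z. ddx (discrete_sol x0 g q \<alpha> n (bh_op n)) z - ddx (u b_op) z)
           - \<bar>g\<bar> * sqrt (x0 * y0 / 3) * (x0 / real n)) \<in> o(\<lambda>n. x0 / real n)"
  proof -
    have exact: "norm_H x0 y0 (\<lambda>z. ddx (discrete_sol x0 g q \<alpha> n (bh_op n)) z - ddx (u b_op) z)
        = \<bar>g\<bar> * sqrt (x0 * y0 / 3) * (x0 / real n)" if "n \<ge> 1" for n
      unfolding norm_H_ddx_error[OF assms(1,2) that, of g q \<alpha> "bh_op n" b_op, symmetric]
      by (rule norm_H_cong) (simp add: ddx_cong_Omega[OF u])
    have "\<forall>\<^sub>F n in sequentially.
        norm_H x0 y0 (\<lambda>z. ddx (discrete_sol x0 g q \<alpha> n (bh_op n)) z - ddx (u b_op) z)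
           - \<bar>g\<bar> * sqrt (x0 * y0 / 3) * (x0 / real n) = 0"
      using eventually_ge_at_top[of 1] by eventually_elim (simp only: exact diff_self)
    then show ?thesis by (subst landau_o.small.in_cong[where g = "\<lambda>_. 0"]) simp_all
  qed
  show ?thesis
    by (rule exI[of _ "norm_H x0 y0 e"], rule exI[of _ "\<bar>g\<bar> * sqrt (x0 * y0 / 3)"], intro conjI ddx_rate)
       (unfold err_norm, rule rate)
qed

end
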